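(* For every $\mathrm{CPG}$-automaton $A$ over a finite token set $\Sigma$, one can construct a tuple of $\Sigma$-formulae of $\mathrm{GPTL}^{-}$ equivalent to $A$: for every $\Sigma$-labelled two-sorted graph $\mathcal G$ and every vertex $v$ in the suffix of $\mathcal G$, the output of the tuple at $(\mathcal G,v)$ equals the output of $A$ at $(\mathcal G,v)$.
   Context: Two-sorted graphs: $\mathrm{BOS}\notin\Sigma$. A $\Sigma$-labelled two-sorted graph is $\mathcal{G}=(V,E,\lambda)$ with $V=[n]$, $E=\{(i,i+1)\}$, $\lambda:V\to\Sigma\cup\{\mathrm{BOS}\}$, exactly one vertex $w$ labelled $\mathrm{BOS}$; prefix = vertices $1,\dots,w-1$, suffix = vertices $w,\dots,n$. $\mathrm{CPG}$-automaton over $\Sigma$: a tuple $(Q,\pi,\delta,n,b)$ with finite nonempty $Q\subseteq\{0,1\}^m$, $\pi:\Sigma\cup\{\mathrm{BOS}\}\to Q$, $\delta:Q\times\mathcal M_k(Q)\times\mathcal M_k(Q)\to Q$ for some $k\in\mathbb N$ where $\mathcal M_k(Q)$ are multisets over $Q$ with multiplicities capped at $k$ ($M_{|k}(x)=\min\{M(x),k\}$), output round $n\in\mathbb N$, output length $b\in\mathbb Z_+$. On a two-sorted graph with $\mathrm{BOS}$ at $w$: $x^0_v=\pi(\lambda(v))$ and $x^{t+1}_v=\delta(x^t_v,\{\{x^t_u\mid u<w\}\}_{|k},\{\{x^t_u\mid w\le u<v\}\}_{|k})$. The output at $(\mathcal G,v)$ is the length-$b$ prefix of $x^n_v$. Logic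 $\mathrm{GPTL}^{-}$: $\varphi::=\bot\mid p\mid\neg\varphi\mid(\varphi\wedge\varphi)\mid\langle G\rangle^{\text{pre}}_{\ge k}\varphi\mid\langle P\rangle^{\text{suf}}\varphi$ ($p\in\Sigma$, $k\in\mathbb N$). At a vertex $w'$ of $\mathcal G$: $\bot$ never holds; $p$ holds iff $\lambda(w')=p$; Boolean connectives as usual; $\langle G\rangle^{\text{pre}}_{\ge k}\varphi$ holds iff at least $k$ prefix vertices satisfy $\varphi$; $\langle P\rangle^{\text{suf}}\varphi$ holds iff some suffix vertex $u<w'$ satisfies $\varphi$. The output of $(\varphi_1,\dots,\varphi_m)$ at $(\mathcal G,v)$ is $b_1\cdots b_m$ with $b_i=1$ iff $\mathcal G,v\models\varphi_i$. *)

theory Defs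
  imports "HOL-Library.Multiset" "HOL-Library.FuncSet"
begin

text \<open>Tokens are drawn from a set \<open>\<Sigma> :: 'a set\<close>; the separate constructor \<open>BOS\<close> makes
  \<open>BOS \<notin> \<Sigma>\<close> hold by construction.\<close>

datatype 'a label = Tok 'a | BOS

definition labels :: "'a set \<Rightarrow> 'a label set" where
  "labels \<Sigma> = insert BOS (Tok ` \<Sigma>)"

record 'a graph =
  verts :: "nat set"
  edges :: "(nat \<times> nat) set"
  lab :: "nat \<Rightarrow> 'a label"

definition two_sorted_graph :: "'a set \<Rightarrow> 'a graph \<Rightarrow> bool" where
  "two_sorted_graph \<Sigma> G \<longleftrightarrow>
     (\<exists>n. verts G = {1..n} \<and> edges G = {(i, i + 1) |i. 1 \<le> i \<and> i < n}) \<and>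
     lab G \<in> verts G \<rightarrow> labels \<Sigma> \<and>
     (\<exists>!w. w \<in> verts G \<and> lab G w = BOS)"

definition bos :: "'a graph \<Rightarrow> nat" where
  "bos G = (THE w. w \<in> verts G \<and> lab G w = BOS)"

definition pre :: "'a graph \<Rightarrow> nat set" where
  "pre G = {u \<in> verts G. u < bos G}"

definition suf :: "'a graph \<Rightarrow> nat set" where
  "suf G = {u \<in> verts G. bos G \<le> u}"

definition cap :: "nat \<Rightarrow> 'q multiset \<Rightarrow> 'q multiset" where
  "cap k M = Abs_multiset (\<lambda>x. min (count M x) k)"

lemma count_cap [simp]: "count (cap k M) x = min (count M x) k"
proof -
  have "{x. 0 < min (count M x) k} \<subseteq> set_mset M" by auto
  then have "finite {x. 0 < min (count M x) k}" by (rule finite_subset) simp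
  then show ?thesis by (simp add: cap_def)
qed

definition capped_msets :: "nat \<Rightarrow> 'q set \<Rightarrow> 'q multiset set" where
  "capped_msets k Q = {M. set_mset M \<subseteq> Q \<and> (\<forall>x. count M x \<le> k)}"

text \<open>Bit strings are Boolean lists. The multiplicity cap \<open>k\<close>, implicit in the domain of the transition function,
  is the component \<open>bound\<close>, since running the automaton needs it.\<close>

record 'a cpg =
  states :: "bool list set"
  init :: "'a label \<Rightarrow> bool list"
  bound :: nat
  step :: "bool list \<times> bool list multiset \<times> bool list multiset \<Rightarrow> bool list"
  out_round :: nat
  out_length :: nat

definition cpg_automaton :: "'a set \<Rightarrow> 'a cpg \<Rightarrow> bool" where
  "cpg_automaton \<Sigma> A \<longleftrightarrow>
     finite (states A) \<and> states A \<noteq> {} \<and>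
     (\<exists>m. states A \<subseteq> {q. length q = m}) \<and>
     init A \<in> labels \<Sigma> \<rightarrow> states A \<and>
     step A \<in> states A \<times> capped_msets (bound A) (states A) \<times> capped_msets (bound A) (states A)
       \<rightarrow> states A \<and>
     0 < out_length A"

primrec run :: "'a cpg \<Rightarrow> 'a graph \<Rightarrow> nat \<Rightarrow> nat \<Rightarrow> bool list" where
  "run A G 0 v = init A (lab G v)"
| "run A G (Suc t) v = step A
     (run A G t v,
      cap (bound A) (image_mset (run A G t) (mset_set (pre G))),
      cap (bound A) (image_mset (run A G t) (mset_set {u \<in> suf G. u < v})))"

definition cpg_output :: "'a cpg \<Rightarrow> 'a graph \<Rightarrow> nat \<Rightarrow> bool list" where
  "cpg_output A G v = take (out_length A) (run A G (out_round A) v)"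

datatype (atoms: 'a) gptl =
    Bot
  | Atom 'a
  | Neg "'a gptl"
  | Conj "'a gptl" "'a gptl"
  | GPre nat "'a gptl"
  | PSuf "'a gptl"

primrec sat :: "'a graph \<Rightarrow> nat \<Rightarrow> 'a gptl \<Rightarrow> bool" where
  "sat G v Bot \<longleftrightarrow> False"
| "sat G v (Atom p) \<longleftrightarrow> lab G v = Tok p"
| "sat G v (Neg \<phi>) \<longleftrightarrow> \<not> sat G v \<phi>"
| "sat G v (Conj \<phi> \<psi>) \<longleftrightarrow> sat G v \<phi> \<and> sat G v \<psi>"
| "sat G v (GPre k \<phi>) \<longleftrightarrow> k \<le> card {u \<in> pre G. sat G u \<phi>}"
| "sat G v (PSuf \<phi>) \<longleftrightarrow> (\<exists>u \<in> suf G. u < v \<and> sat G u \<phi>)"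

definition is_formula :: "'a set \<Rightarrow> 'a gptl \<Rightarrow> bool" where
  "is_formula \<Sigma> \<phi> \<longleftrightarrow> atoms \<phi> \<subseteq> \<Sigma>"

definition tuple_output :: "'a gptl list \<Rightarrow> 'a graph \<Rightarrow> nat \<Rightarrow> bool list" where
  "tuple_output \<phi>s G v = map (sat G v) \<phi>s"

end

theory Submission
  imports Defs
begin

text \<open>Call a function on pointed graphs definable if it takes finitely many values, each on a set of
  pointed graphs cut out by a formula. Definable functions are closed under pairing and under
  composition with arbitrary functions, so by induction on the round every state of the automaton
  is definable once the capped multisets are. The prefix multiset is expressed by the counting modality; for
  the suffix, the strictness of \<open>PSuf\<close> allows counting by nesting: at least \<open>k + 1\<close> earlier suffix
  vertices satisfy \<open>\<phi>\<close> iff some earlier suffix vertex satisfies \<open>\<phi>\<close> and has at least \<open>k\<close> such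
  vertices before it.\<close>

section \<open>Definable functions and their closure properties\<close>

definition definable :: "'a set \<Rightarrow> ('a graph \<Rightarrow> nat \<Rightarrow> 'b) \<Rightarrow> bool" where
  "definable \<Sigma> f \<longleftrightarrow>
     (\<exists>S. finite S \<and> (\<forall>G v. two_sorted_graph \<Sigma> G \<longrightarrow> v \<in> verts G \<longrightarrow> f G v \<in> S)) \<and>
     (\<forall>q. \<exists>\<phi>. is_formula \<Sigma> \<phi> \<and>
        (\<forall>G v. two_sorted_graph \<Sigma> G \<longrightarrow> v \<in> verts G \<longrightarrow> (sat G v \<phi> \<longleftrightarrow> f G v = q)))"

lemma definable_range:
  assumes "definable \<Sigma> f"
  obtains S where "finite S"
    "\<And>G v. two_sorted_graph \<Sigma> G \<Longrightarrow> v \<in> verts G \<Longrightarrow> f G v \<in> S"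
  using assms unfolding definable_def by blast

lemma definable_formula:
  assumes "definable \<Sigma> f"
  obtains \<phi> where "is_formula \<Sigma> \<phi>"
    "\<And>G v. two_sorted_graph \<Sigma> G \<Longrightarrow> v \<in> verts G \<Longrightarrow> sat G v \<phi> \<longleftrightarrow> f G v = q"
proof -
  from assms have "\<exists>\<phi>. is_formula \<Sigma> \<phi> \<and>
      (\<forall>G v. two_sorted_graph \<Sigma> G \<longrightarrow> v \<in> verts G \<longrightarrow> (sat G v \<phi> \<longleftrightarrow> f G v = q))"
    by (simp add: definable_def)
  then show thesis using that by blast
qed

lemma definable_cong:
  assumes "definable \<Sigma> f"
    and "\<And>G v. two_sorted_graph \<Sigma> G \<Longrightarrow> v \<in> verts G \<Longrightarrow> g G v = f G v"
  shows "definable \<Sigma> g"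
  using assms unfolding definable_def by simp

text \<open>Predicates are treated as \<open>bool\<close>-valued functions, so the closure lemmas
  for functions apply to truth values too. The value \<open>False\<close> is cut out by the negated
  formula.\<close>

lemma definable_formulaI:
  assumes "is_formula \<Sigma> \<phi>"
    and "\<And>G v. two_sorted_graph \<Sigma> G \<Longrightarrow> v \<in> verts G \<Longrightarrow> sat G v \<phi> \<longleftrightarrow> P G v"
  shows "definable \<Sigma> P"
  unfolding definable_def
proof (intro conjI allI)
  show "\<exists>S. finite S \<and> (\<forall>G v. two_sorted_graph \<Sigma> G \<longrightarrow> v \<in> verts G \<longrightarrow> P G v \<in> S)"
    by (rule exI[of _ UNIV]) simp
  fix q
  have "is_formula \<Sigma> (if q then \<phi> else Neg \<phi>)"
    using assms(1) by (simp add: is_formula_def)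
  then show "\<exists>\<phi>. is_formula \<Sigma> \<phi> \<and>
      (\<forall>G v. two_sorted_graph \<Sigma> G \<longrightarrow> v \<in> verts G \<longrightarrow> (sat G v \<phi> \<longleftrightarrow> P G v = q))"
    using assms(2) by (intro exI[of _ "if q then \<phi> else Neg \<phi>"]) auto
qed

text \<open>The syntax offers only negation and binary conjunction, so disjunctions are built by De
  Morgan, starting from \<open>Bot\<close> for the empty one.\<close>

lemma finite_disjunction_formula:
  assumes "finite I" and "\<And>i. i \<in> I \<Longrightarrow> is_formula \<Sigma> (\<phi> i)"
  shows "\<exists>\<psi>. is_formula \<Sigma> \<psi> \<and> (\<forall>G v. sat G v \<psi> \<longleftrightarrow> (\<exists>i\<in>I. sat G v (\<phi> i)))"
  using assms
proof (induction I)
  case empty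
  show ?case by (rule exI[of _ Bot]) (simp add: is_formula_def)
next
  case (insert i I)
  then obtain \<psi> where "is_formula \<Sigma> \<psi>" "\<And>G v. sat G v \<psi> \<longleftrightarrow> (\<exists>i\<in>I. sat G v (\<phi> i))"
    by auto
  moreover have "is_formula \<Sigma> (\<phi> i)" using insert.prems by simp
  ultimately show ?case
    by (intro exI[of _ "Neg (Conj (Neg (\<phi> i)) (Neg \<psi>))"]) (simp add: is_formula_def)
qed

lemma definable_const: "definable \<Sigma> (\<lambda>G v. c)"
  unfolding definable_def
proof (intro conjI allI)
  show "\<exists>S. finite S \<and> (\<forall>G v. two_sorted_graph \<Sigma> G \<longrightarrow> v \<in> verts G \<longrightarrow> c \<in> S)"
    by (rule exI[of _ "{c}"]) simp
  show "\<exists>\<phi>. is_formula \<Sigma> \<phi> \<and>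
      (\<forall>G v. two_sorted_graph \<Sigma> G \<longrightarrow> v \<in> verts G \<longrightarrow> (sat G v \<phi> \<longleftrightarrow> c = q))" for q
    by (rule exI[of _ "if c = q then Neg Bot else Bot"]) (simp add: is_formula_def)
qed

text \<open>The preimage of \<open>q\<close> under \<open>h\<close> meets the range of
  \<open>f\<close> in finitely many values, so the formulae for these values have a finite
  disjunction. This is why definability demands a finite range.\<close>

lemma definable_compose:
  assumes "definable \<Sigma> f"
  shows "definable \<Sigma> (\<lambda>G v. h (f G v))"
proof -
  obtain S where S: "finite S"
      "\<And>G v. two_sorted_graph \<Sigma> G \<Longrightarrow> v \<in> verts G \<Longrightarrow> f G v \<in> S"
    using definable_range[OF assms] by metis
  obtain \<phi> where \<phi>: "\<And>s. is_formula \<Sigma> (\<phi> s)"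
      "\<And>s G v. two_sorted_graph \<Sigma> G \<Longrightarrow> v \<in> verts G \<Longrightarrow> sat G v (\<phi> s) \<longleftrightarrow> f G v = s"
    using assms unfolding definable_def by metis
  show ?thesis
    unfolding definable_def
  proof (intro conjI allI)
    show "\<exists>S. finite S \<and> (\<forall>G v. two_sorted_graph \<Sigma> G \<longrightarrow> v \<in> verts G \<longrightarrow> h (f G v) \<in> S)"
      using S by (intro exI[of _ "h ` S"]) auto
    fix q
    obtain \<psi> where "is_formula \<Sigma> \<psi>"
        "\<And>G v. sat G v \<psi> \<longleftrightarrow> (\<exists>s\<in>{s \<in> S. h s = q}. sat G v (\<phi> s))"
      using finite_disjunction_formula[of "{s \<in> S. h s = q}" \<Sigma> \<phi>] S(1) \<phi>(1) by auto
    then show "\<exists>\<psi>. is_formula \<Sigma> \<psi> \<and>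
        (\<forall>G v. two_sorted_graph \<Sigma> G \<longrightarrow> v \<in> verts G \<longrightarrow> (sat G v \<psi> \<longleftrightarrow> h (f G v) = q))"
      using S(2) \<phi>(2) by (intro exI[of _ \<psi>]) auto
  qed
qed

lemma definable_Pair:
  assumes "definable \<Sigma> f" and "definable \<Sigma> g"
  shows "definable \<Sigma> (\<lambda>G v. (f G v, g G v))"
  unfolding definable_def
proof (intro conjI allI)
  obtain S where S: "finite S"
      "\<And>G v. two_sorted_graph \<Sigma> G \<Longrightarrow> v \<in> verts G \<Longrightarrow> f G v \<in> S"
    using definable_range[OF assms(1)] by metis
  obtain T where T: "finite T"
      "\<And>G v. two_sorted_graph \<Sigma> G \<Longrightarrow> v \<in> verts G \<Longrightarrow> g G v \<in> T"
    using definable_range[OF assms(2)] by metis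
  show "\<exists>S. finite S \<and>
      (\<forall>G v. two_sorted_graph \<Sigma> G \<longrightarrow> v \<in> verts G \<longrightarrow> (f G v, g G v) \<in> S)"
    using S T by (intro exI[of _ "S \<times> T"]) auto
  fix q :: "'b \<times> 'c"
  obtain \<phi> where \<phi>: "is_formula \<Sigma> \<phi>"
      "\<And>G v. two_sorted_graph \<Sigma> G \<Longrightarrow> v \<in> verts G \<Longrightarrow> sat G v \<phi> \<longleftrightarrow> f G v = fst q"
    using definable_formula[OF assms(1)] by metis
  obtain \<psi> where \<psi>: "is_formula \<Sigma> \<psi>"
      "\<And>G v. two_sorted_graph \<Sigma> G \<Longrightarrow> v \<in> verts G \<Longrightarrow> sat G v \<psi> \<longleftrightarrow> g G v = snd q"
    using definable_formula[OF assms(2)] by metis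
  show "\<exists>\<phi>. is_formula \<Sigma> \<phi> \<and> (\<forall>G v. two_sorted_graph \<Sigma> G \<longrightarrow> v \<in> verts G \<longrightarrow>
      (sat G v \<phi> \<longleftrightarrow> (f G v, g G v) = q))"
    using \<phi> \<psi> by (intro exI[of _ "Conj \<phi> \<psi>"]) (auto simp: is_formula_def)
qed

lemma definable_compose2:
  assumes "definable \<Sigma> f" and "definable \<Sigma> g"
  shows "definable \<Sigma> (\<lambda>G v. h (f G v) (g G v))"
  using definable_compose[OF definable_Pair[OF assms], of "case_prod h"] by simp

lemma definable_sum:
  fixes f :: "'i \<Rightarrow> 'a graph \<Rightarrow> nat \<Rightarrow> 'b :: comm_monoid_add"
  assumes "finite I" and "\<And>i. i \<in> I \<Longrightarrow> definable \<Sigma> (f i)"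
  shows "definable \<Sigma> (\<lambda>G v. \<Sum>i\<in>I. f i G v)"
  using assms
proof (induction I)
  case empty
  show ?case by (simp add: definable_const)
next
  case (insert i I)
  then have "definable \<Sigma> (\<lambda>G v. f i G v + (\<Sum>i\<in>I. f i G v))"
    by (simp add: definable_compose2[of _ _ _ "(+)"])
  then show ?case using insert.hyps by simp
qed

lemma definable_ball:
  assumes "finite I" and "\<And>i. i \<in> I \<Longrightarrow> definable \<Sigma> (P i)"
  shows "definable \<Sigma> (\<lambda>G v. \<forall>i\<in>I. P i G v)"
  using assms
proof (induction I)
  case empty
  show ?case by (simp add: definable_const)
next
  case (insert i I)
  then have "definable \<Sigma> (\<lambda>G v. P i G v \<and> (\<forall>i\<in>I. P i G v))"
    by (simp add: definable_compose2[of _ _ _ "(\<and>)"])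
  then show ?case by simp
qed

text \<open>The function \<open>c\<close> may be unbounded and hence not definable itself, but each
  threshold test is. Passing from \<open>k\<close> to \<open>Suc k\<close> changes the capped value
  only where \<open>Suc k \<le> c G v\<close>, and there it becomes \<open>Suc k\<close>.\<close>

lemma definable_min:
  fixes c :: "'a graph \<Rightarrow> nat \<Rightarrow> nat"
  assumes "\<And>j. definable \<Sigma> (\<lambda>G v. j \<le> c G v)"
  shows "definable \<Sigma> (\<lambda>G v. min (c G v) k)"
proof (induction k)
  case 0
  show ?case by (simp add: definable_const)
next
  case (Suc k)
  have "definable \<Sigma> (\<lambda>G v. (\<lambda>m b. if b then Suc k else m) (min (c G v) k) (Suc k \<le> c G v))"
    by (rule definable_compose2[OF Suc assms])
  then show ?case by (rule definable_cong) auto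
qed

lemma definable_pred_formula:
  assumes "definable \<Sigma> P"
  shows "\<exists>\<phi>. is_formula \<Sigma> \<phi> \<and>
    (\<forall>G v. two_sorted_graph \<Sigma> G \<longrightarrow> v \<in> verts G \<longrightarrow> (sat G v \<phi> \<longleftrightarrow> P G v))"
  by (rule definable_formula[OF assms, of True]) auto

section \<open>Definability of the labelling\<close>

lemma lab_in_labels: "two_sorted_graph \<Sigma> G \<Longrightarrow> v \<in> verts G \<Longrightarrow> lab G v \<in> labels \<Sigma>"
  by (simp add: two_sorted_graph_def Pi_iff)

lemma definable_label:
  assumes "finite \<Sigma>"
  shows "definable \<Sigma> (\<lambda>G v. lab G v)"
  unfolding definable_def
proof (intro conjI allI)
  show "\<exists>S. finite S \<and> (\<forall>G v. two_sorted_graph \<Sigma> G \<longrightarrow> v \<in> verts G \<longrightarrow> lab G v \<in> S)"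
    using assms
    by (intro exI[of _ "labels \<Sigma>"]) (auto simp: lab_in_labels, simp add: labels_def)
  have tok: "definable \<Sigma> (\<lambda>G v. lab G v = Tok p)" if "p \<in> \<Sigma>" for p
    by (rule definable_formulaI[of _ "Atom p"]) (use that in \<open>auto simp: is_formula_def\<close>)
  have "definable \<Sigma> (\<lambda>G v. lab G v = q)" for q
  proof (cases q)
    case (Tok p)
    show ?thesis
    proof (cases "p \<in> \<Sigma>")
      case True
      then show ?thesis using tok Tok by simp
    next
      case False
      \<comment> \<open>A token outside \<open>\<Sigma>\<close> labels no vertex, and
        \<open>Atom p\<close> would not be a formula over \<open>\<Sigma>\<close>; the constant
        \<open>False\<close> replaces it.\<close>
      show ?thesis
        by (rule definable_cong[OF definable_const[of _ False]])
          (use Tok False in \<open>auto simp: labels_def dest: lab_in_labels\<close>)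
    qed
  next
    case BOS
    \<comment> \<open>The logic has no atom for \<open>BOS\<close>. It is recognised by the absence
      of every token, a finite conjunction because \<open>\<Sigma>\<close> is finite.\<close>
    have "definable \<Sigma> (\<lambda>G v. \<forall>p\<in>\<Sigma>. \<not> lab G v = Tok p)"
      by (intro definable_ball definable_compose[of _ _ Not] tok assms)
    then show ?thesis
      by (rule definable_cong)
        (use BOS in \<open>fastforce simp: labels_def dest: lab_in_labels\<close>)
  qed
  from definable_pred_formula[OF this]
  show "\<exists>\<phi>. is_formula \<Sigma> \<phi> \<and> (\<forall>G v. two_sorted_graph \<Sigma> G \<longrightarrow> v \<in> verts G \<longrightarrow>
      (sat G v \<phi> \<longleftrightarrow> lab G v = q))" for q .
qed

section \<open>Counting in the prefix and in the suffix\<close>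

lemma pre_subset_verts: "pre G \<subseteq> verts G"
  by (auto simp: pre_def)

lemma suf_subset_verts: "suf G \<subseteq> verts G"
  by (auto simp: suf_def)

lemma finite_verts: "two_sorted_graph \<Sigma> G \<Longrightarrow> finite (verts G)"
  unfolding two_sorted_graph_def by (elim conjE exE) simp

lemma finite_pre: "two_sorted_graph \<Sigma> G \<Longrightarrow> finite (pre G)"
  using finite_verts pre_subset_verts by (rule finite_subset[rotated])

lemma finite_suf: "two_sorted_graph \<Sigma> G \<Longrightarrow> finite (suf G)"
  using finite_verts suf_subset_verts by (rule finite_subset[rotated])

text \<open>Forwards, \<open>u\<close> is the greatest element of \<open>S\<close> below
  \<open>v\<close>, since all other elements of \<open>S\<close> below \<open>v\<close> lie below
  it. Backwards, \<open>u\<close> itself adds one to the elements below it.\<close>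

lemma Suc_le_card_below_iff:
  fixes S :: "'a :: linorder set"
  assumes "finite S"
  shows "Suc k \<le> card {u \<in> S. u < v} \<longleftrightarrow> (\<exists>u\<in>S. u < v \<and> k \<le> card {w \<in> S. w < u})"
proof
  assume *: "Suc k \<le> card {u \<in> S. u < v}"
  let ?X = "{u \<in> S. u < v}"
  have "finite ?X" using assms by simp
  have "?X \<noteq> {}" using * by (metis card.empty not_less_eq_eq le0)
  with \<open>finite ?X\<close> have m: "Max ?X \<in> ?X" by (rule Max_in)
  have "?X - {Max ?X} \<subseteq> {w \<in> S. w < Max ?X}"
    using \<open>finite ?X\<close> by (auto simp: order_less_le)
  then have "card (?X - {Max ?X}) \<le> card {w \<in> S. w < Max ?X}"
    using assms by (intro card_mono) auto
  with * m show "\<exists>u\<in>S. u < v \<and> k \<le> card {w \<in> S. w < u}"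
    by (intro bexI[of _ "Max ?X"]) auto
next
  assume "\<exists>u\<in>S. u < v \<and> k \<le> card {w \<in> S. w < u}"
  then obtain u where u: "u \<in> S" "u < v" "k \<le> card {w \<in> S. w < u}" by blast
  have "card (insert u {w \<in> S. w < u}) \<le> card {u \<in> S. u < v}"
    using assms u by (intro card_mono) auto
  then show "Suc k \<le> card {u \<in> S. u < v}" using assms u by simp
qed

primrec at_least_suf :: "nat \<Rightarrow> 'a gptl \<Rightarrow> 'a gptl" where
  "at_least_suf 0 \<phi> = Neg Bot"
| "at_least_suf (Suc k) \<phi> = PSuf (Conj \<phi> (at_least_suf k \<phi>))"

lemma is_formula_at_least_suf: "is_formula \<Sigma> \<phi> \<Longrightarrow> is_formula \<Sigma> (at_least_suf k \<phi>)"
  by (induction k) (auto simp: is_formula_def)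

text \<open>The inductive step is \<open>Suc_le_card_below_iff\<close> for the set of suffix
  vertices satisfying \<open>\<phi>\<close>; the induction hypothesis is needed at the witness
  \<open>u\<close>, so \<open>v\<close> is generalised.\<close>

lemma sat_at_least_suf:
  assumes "finite (suf G)"
  shows "sat G v (at_least_suf k \<phi>) \<longleftrightarrow> k \<le> card {u \<in> suf G. u < v \<and> sat G u \<phi>}"
proof (induction k arbitrary: v)
  case (Suc k)
  have "{u \<in> suf G. u < v \<and> sat G u \<phi>} = {u \<in> {u \<in> suf G. sat G u \<phi>}. u < v}" for v
    by auto
  then show ?case
    using Suc Suc_le_card_below_iff[of "{u \<in> suf G. sat G u \<phi>}" k v] assms by auto
qed simp

text \<open>\<open>GPre\<close> evaluates its argument at prefix vertices, which is why definability
  ranges over all vertices and not over the suffix alone.\<close>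

lemma definable_card_pre:
  assumes "definable \<Sigma> f"
  shows "definable \<Sigma> (\<lambda>G v. j \<le> card {u \<in> pre G. f G u = q})"
proof -
  obtain \<phi> where \<phi>: "is_formula \<Sigma> \<phi>"
      "\<And>G v. two_sorted_graph \<Sigma> G \<Longrightarrow> v \<in> verts G \<Longrightarrow> sat G v \<phi> \<longleftrightarrow> f G v = q"
    using definable_formula[OF assms] by metis
  have "{u \<in> pre G. sat G u \<phi>} = {u \<in> pre G. f G u = q}" if "two_sorted_graph \<Sigma> G" for G
    using \<phi>(2)[OF that] pre_subset_verts[of G] by auto
  with \<phi>(1) show ?thesis
    by (intro definable_formulaI[of _ "GPre j \<phi>"]) (simp_all add: is_formula_def)
qed

text \<open>The nested comprehension has the shape \<open>{u \<in> X G v. f G u = q}\<close> that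
  \<open>definable_cap_image_mset\<close> asks for.\<close>

lemma definable_card_suf:
  assumes "definable \<Sigma> f"
  shows "definable \<Sigma> (\<lambda>G v. j \<le> card {u \<in> {u \<in> suf G. u < v}. f G u = q})"
proof -
  obtain \<phi> where \<phi>: "is_formula \<Sigma> \<phi>"
      "\<And>G v. two_sorted_graph \<Sigma> G \<Longrightarrow> v \<in> verts G \<Longrightarrow> sat G v \<phi> \<longleftrightarrow> f G v = q"
    using definable_formula[OF assms] by metis
  have "{u \<in> suf G. u < v \<and> sat G u \<phi>} = {u \<in> {u \<in> suf G. u < v}. f G u = q}"
    if "two_sorted_graph \<Sigma> G" for G v
    using \<phi>(2)[OF that] suf_subset_verts[of G] by auto
  with \<phi>(1) show ?thesis
    by (intro definable_formulaI[of _ "at_least_suf j \<phi>"])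
      (simp_all add: is_formula_at_least_suf sat_at_least_suf finite_suf)
qed

section \<open>Definability of capped multisets\<close>

text \<open>Splitting the multiset by values makes each summand a function of one capped
  cardinality, so that \<open>definable_min\<close> and \<open>definable_sum\<close> apply.\<close>

lemma cap_image_mset_eq_sum:
  assumes "finite X" and "finite S" and "f ` X \<subseteq> S"
  shows "cap k (image_mset f (mset_set X)) =
    (\<Sum>q\<in>S. replicate_mset (min (card {u \<in> X. f u = q}) k) q)"
proof (rule multiset_eqI)
  fix q
  have "count (image_mset f (mset_set X)) q = card {u \<in> X. q = f u}"
    using assms(1) by (simp add: count_image_mset')
  moreover have "{u \<in> X. q = f u} = {u \<in> X. f u = q}" by auto
  \<comment> \<open>Outside \<open>S\<close> the sum has no summand, so the count on the left has to
    vanish.\<close>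
  moreover have "{u \<in> X. f u = q} = {}" if "q \<notin> S" using that assms(3) by blast
  then have "card {u \<in> X. f u = q} = 0" if "q \<notin> S" using that by (metis card.empty)
  ultimately show "count (cap k (image_mset f (mset_set X))) q =
      count (\<Sum>q\<in>S. replicate_mset (min (card {u \<in> X. f u = q}) k) q) q"
    using assms(2) by (simp add: count_sum)
qed

text \<open>The finite range \<open>S\<close> of \<open>f\<close> is the same for all graphs, so one
  sum over \<open>S\<close> describes the multiset uniformly. The parameter \<open>X\<close> covers
  both the prefix and the earlier suffix vertices.\<close>

lemma definable_cap_image_mset:
  assumes f: "definable \<Sigma> f"
    and sub: "\<And>G v. two_sorted_graph \<Sigma> G \<Longrightarrow> X G v \<subseteq> verts G"
    and card: "\<And>j q. definable \<Sigma> (\<lambda>G v. j \<le> card {u \<in> X G v. f G u = q})"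
  shows "definable \<Sigma> (\<lambda>G v. cap k (image_mset (f G) (mset_set (X G v))))"
proof -
  obtain S where S: "finite S"
      "\<And>G v. two_sorted_graph \<Sigma> G \<Longrightarrow> v \<in> verts G \<Longrightarrow> f G v \<in> S"
    using definable_range[OF f] by metis
  have "definable \<Sigma> (\<lambda>G v. \<Sum>q\<in>S. replicate_mset (min (card {u \<in> X G v. f G u = q}) k) q)"
    by (intro definable_sum S(1) definable_compose[of _ _ "\<lambda>n. replicate_mset n _"]
        definable_min card)
  then show ?thesis
  proof (rule definable_cong)
    fix G v assume G: "two_sorted_graph \<Sigma> G"
    have "finite (X G v)" using finite_verts[OF G] sub[OF G] by (rule finite_subset[rotated])
    then show "cap k (image_mset (f G) (mset_set (X G v))) =
        (\<Sum>q\<in>S. replicate_mset (min (card {u \<in> X G v. f G u = q}) k) q)"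
      by (rule cap_image_mset_eq_sum) (use S sub[OF G] G in auto)
  qed
qed

section \<open>The run of the automaton and its output\<close>

text \<open>Each round composes \<open>step A\<close> with a triple of definable functions. The
  finite range needed for the next round is carried along by definability itself.\<close>

lemma definable_run:
  assumes "finite \<Sigma>"
  shows "definable \<Sigma> (\<lambda>G v. run A G t v)"
proof (induction t)
  case 0
  show ?case using definable_compose[OF definable_label[OF assms]] by simp
next
  case (Suc t)
  have "definable \<Sigma> (\<lambda>G v. cap (bound A) (image_mset (run A G t) (mset_set (pre G))))"
    by (rule definable_cap_image_mset[OF Suc pre_subset_verts definable_card_pre[OF Suc]])
  moreover have "definable \<Sigma>
      (\<lambda>G v. cap (bound A) (image_mset (run A G t) (mset_set {u \<in> suf G. u < v})))"
    by (rule definable_cap_image_mset[OF Suc _ definable_card_suf[OF Suc]])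
      (use suf_subset_verts in auto)
  ultimately show ?case
    unfolding run.simps by (intro definable_compose[of _ _ "step A"] definable_Pair Suc)
qed

lemma cap_image_mset_in_capped_msets:
  assumes "finite X" and "f ` X \<subseteq> Q"
  shows "cap k (image_mset f (mset_set X)) \<in> capped_msets k Q"
proof -
  have "set_mset (cap k M) \<subseteq> set_mset M" for M :: "'b multiset"
    by (auto simp flip: count_greater_zero_iff)
  from this[of "image_mset f (mset_set X)"] show ?thesis
    using assms by (auto simp: capped_msets_def)
qed

text \<open>Serves to fix the length of the bit string reached at a vertex, on which the length of
  the formula tuple depends.\<close>

lemma run_in_states:
  assumes A: "cpg_automaton \<Sigma> A" and G: "two_sorted_graph \<Sigma> G" and "v \<in> verts G"
  shows "run A G t v \<in> states A"
  using \<open>v \<in> verts G\<close>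
proof (induction t arbitrary: v)
  case 0
  then show ?case using A lab_in_labels[OF G] by (simp add: cpg_automaton_def Pi_iff)
next
  case (Suc t)
  have "cap (bound A) (image_mset (run A G t) (mset_set X)) \<in> capped_msets (bound A) (states A)"
    if "X \<subseteq> verts G" for X
    by (rule cap_image_mset_in_capped_msets)
      (use that Suc.IH finite_subset[OF that finite_verts[OF G]] in auto)
  moreover have "{u \<in> suf G. u < v} \<subseteq> verts G" using suf_subset_verts by auto
  ultimately show ?case
    using A Suc pre_subset_verts[of G] by (simp add: cpg_automaton_def Pi_iff)
qed

theorem theorem3:
  fixes \<Sigma> :: "'a set" and A :: "'a cpg"
  assumes "finite \<Sigma>" and "cpg_automaton \<Sigma> A"
  shows "\<exists>\<phi>s :: 'a gptl list.
    (\<forall>\<phi> \<in> set \<phi>s. is_formula \<Sigma> \<phi>) \<and>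
    (\<forall>G v. two_sorted_graph \<Sigma> G \<longrightarrow> v \<in> suf G \<longrightarrow>
       tuple_output \<phi>s G v = cpg_output A G v)"
proof -
  obtain m where m: "\<And>q. q \<in> states A \<Longrightarrow> length q = m"
    using assms(2) by (auto simp: cpg_automaton_def)
  \<comment> \<open>Reading bit \<open>i\<close> is composition with a function on bit strings.
    Beyond the length \<open>m\<close> its value is unspecified, but only indices below
    \<open>m\<close> enter the tuple.\<close>
  have "definable \<Sigma> (\<lambda>G v. run A G (out_round A) v ! i)" for i
    by (rule definable_compose[OF definable_run[OF assms(1)]])
  then have "\<exists>\<phi>. is_formula \<Sigma> \<phi> \<and> (\<forall>G v. two_sorted_graph \<Sigma> G \<longrightarrow> v \<in> verts G \<longrightarrow>
      (sat G v \<phi> \<longleftrightarrow> run A G (out_round A) v ! i))" for i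
    by (rule definable_pred_formula)
  then obtain \<phi> where \<phi>: "\<And>i. is_formula \<Sigma> (\<phi> i)"
      "\<And>i G v. two_sorted_graph \<Sigma> G \<Longrightarrow> v \<in> verts G \<Longrightarrow>
        sat G v (\<phi> i) \<longleftrightarrow> run A G (out_round A) v ! i"
    by metis
  \<comment> \<open>The minimum matches \<open>take\<close>, which returns the whole state when the
    output length exceeds \<open>m\<close>.\<close>
  have "tuple_output (map \<phi> [0..<min m (out_length A)]) G v = cpg_output A G v"
    if G: "two_sorted_graph \<Sigma> G" and "v \<in> suf G" for G v
  proof -
    have v: "v \<in> verts G" using that(2) suf_subset_verts by blast
    show ?thesis
      using m[OF run_in_states[OF assms(2) G v]] \<phi>(2)[OF G v]
      by (intro nth_equalityI) (auto simp: tuple_output_def cpg_output_def)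
  qed
  with \<phi>(1) show ?thesis
    by (intro exI[of _ "map \<phi> [0..<min m (out_length A)]"]) auto
qed

end
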